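(* No stable base contains Rule $P_1$ or Rule $P_2$, where $P_1$ is the rule implementing the diagram $A,\ \neg_\rho A\,/\,\mathcal{F}$ and $P_2$ is the rule implementing the diagram $A,\ \neg_\rho A\,/\,B$.
   Context: Framework. Algorithms are recursive algorithms in a fixed standard model. A datum is anything that can be input to an algorithm; data include natural numbers and algorithms, and every finite list of data is a datum. Every algorithm accepts exactly one input datum and either does not halt or halts with exactly one output datum. Every datum has a positive integer size, only finitely many data have a given size, and the size of a list is strictly greater than the sum of the sizes of its items. A process is a pair (algorithm, input). Every halting process has a positive integer runtime; if a process runs subprocesses in its execution, its runtime is strictly greater than the sum of the runtimes of the halting subprocesses. An algorithmic statement is a datum $[\alpha,u,v]$ with $\alpha$ an algorithm, asserting that $\alpha$ with input $u$ halts with output $v$; it is true if this is so and false otherwise. $\mathcal{F}$ denotes the false statement $[\mathrm{identity},0,1]$, where $\mathrm{identity}$ outputs a copy of its input. Rules and libraries. An algorithmic sequence is an algorithm $\rho$ that halts on every positive integer $n$; its output is written $\rho_n$. A rule is an algorithm which, on every input $[H,\rho,m]$ with $H$ a finite list of algorithmic statements (hypothesis list), $\rho$ an algorithmic sequence (nominal library) and $m$ a positive integer (resource integer), halts and outputs a list of algorithmic statements (conclusion list) having $H$ as an initial sublist, and which is monotone: if $m'\ge m$ and every item of $H$ is an item of $H'$, then every item of the output on $[H,\rho,m]$ is an item of the output on $[H',\rho,m']$. A library is an algorithmic sequence $\rho$ such that every $\rho_n$ is a rule (not necessarily distinct); the $\rho_n$ are the rules contained in $\rho$. A rule is $\rho$-valid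 if for every list $H$ of true statements and every $m$, its output on $[H,\rho,m]$ consists only of true statements. A library $\rho$ is valid if all its rules are $\rho$-valid. Bases. A base is a set $\mathcal{B}$ of rules that is finite or is the set of terms of a library. A $\mathcal{B}$-library is a library containing all rules of $\mathcal{B}$. A $\mathcal{B}$-library $\rho$ is valid outside $\mathcal{B}$ if every rule in $\rho$ which is not in $\mathcal{B}$ is $\rho$-valid. A base $\mathcal{B}$ is stable if every $\mathcal{B}$-library that is valid outside $\mathcal{B}$ is valid. Deduction. Fix a recursive bijection $f:\mathbb{N}_+\to\mathbb{N}_+\times\mathbb{N}_+$. The algorithm $\mathrm{deduce}$, on input $[\Gamma,\rho,B]$ ($\Gamma$ a list of algorithmic statements, $\rho$ a library, $B$ an algorithmic statement), computes lists $H_0=\Gamma,H_1,H_2,\dots$, where for $i>0$ with $f(i)=(k,m)$ the list $H_i$ is the output of $\rho_k$ on $[H_{i-1},\rho,m]$; after computing each $H_i$ it checks whether $B$ is on $H_i$, outputs $1$ if so, and otherwise continues. The algorithmic statement $[\mathrm{deduce},[\Gamma,\rho,B],1]$ is denoted $\Gamma\vdash_\rho B$ (the notation is used for any datum $\rho$), and $A_1,\dots,A_n\vdash_\rho B$ means this with $\Gamma=[A_1,\dots,A_n]$. $A\Rightarrow_\rho B$ denotes $A\vdash_\rho B$, and $\neg_\rho A$ denotes $A\Rightarrow_\rho\mathcal{F}$. Rule diagrams. A rule implementing "$X_1,\dots,X_r\,/\,Y$" is the algorithm which on input $[H,\rho,m]$ outputs $H$ with $Y$ appended for every instance (letters $A,B$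 ranging over algorithmic statements) whose premises $X_1,\dots,X_r$ are all on $H$; the $\rho$ in $\neg_\rho$ is the nominal library in the input. For $P_2$, whose conclusion $B$ does not occur in the premises, only those $B$ of size at most $m$ are appended. *)

theory Defs
  imports Main "HOL-Library.Nat_Bijection" "HOL-Library.Sublist"
begin

section \<open>Partial recursive functions on the natural numbers\<close>

text \<open>Kleene's schemes. Arities are not tracked: a term denotes a partial function on argument
  lists, undefined where the list is too short.\<close>

datatype recf = Zero | Succ | Proj nat | Comp recf "recf list" | Prec recf recf | Mu recf

fun rec_val :: "recf \<Rightarrow> nat list \<Rightarrow> nat option" where
  "rec_val Zero xs = Some 0"
| "rec_val Succ xs = (case xs of [] \<Rightarrow> None | x # _ \<Rightarrow> Some (Suc x))"
| "rec_val (Proj i) xs = (if i < length xs then Some (xs ! i) else None)"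
| "rec_val (Comp f gs) xs =
     Option.bind (those (map (\<lambda>g. rec_val g xs) gs)) (\<lambda>ys. rec_val f ys)"
| "rec_val (Prec f g) xs =
     (case xs of [] \<Rightarrow> None
      | n # ys \<Rightarrow> rec_nat (rec_val f ys)
                   (\<lambda>k r. Option.bind r (\<lambda>z. rec_val g (k # z # ys))) n)"
| "rec_val (Mu f) xs =
     (if \<exists>n. rec_val f (n # xs) = Some 0 \<and> (\<forall>k<n. \<exists>y>0. rec_val f (k # xs) = Some y)
      then Some (LEAST n. rec_val f (n # xs) = Some 0) else None)"

definition partial_recursive :: "(nat \<Rightarrow> nat option) \<Rightarrow> bool" where
  "partial_recursive g \<longleftrightarrow> (\<exists>r. \<forall>x. g x = rec_val r [x])"


section \<open>Data and algorithms\<close>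

text \<open>The type \<open>'d\<close> is the type of all data. The components \<open>run\<close>, \<open>runtime\<close> and \<open>subprocs\<close> are
  meaningful only for algorithms, i.e. when the first argument is in \<open>alg\<close>; \<open>None\<close> means that the
  process does not halt. The list \<open>subprocs M \<alpha> u\<close> gives the processes (algorithm, input) that the
  halting process \<open>(\<alpha>, u)\<close> runs in its execution, with repetitions.\<close>

record 'd model =
  num :: "nat \<Rightarrow> 'd"
  lst :: "'d list \<Rightarrow> 'd"
  alg :: "'d set"
  run :: "'d \<Rightarrow> 'd \<Rightarrow> 'd option"
  dsize :: "'d \<Rightarrow> nat"
  runtime :: "'d \<Rightarrow> 'd \<Rightarrow> nat"
  subprocs :: "'d \<Rightarrow> 'd \<Rightarrow> ('d \<times> 'd) list"

text \<open>What makes the algorithms of a model ``the recursive algorithms'': under a numbering of the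
  data for which numerals and lists are formed effectively, running an algorithm on an input is
  partial recursive uniformly in both, and every partial recursive function is computed by an
  algorithm. Taking numerals and lists apart is then effective by search.\<close>

definition effective_numbering :: "('d, 'z) model_scheme \<Rightarrow> ('d \<Rightarrow> nat) \<Rightarrow> bool" where
  "effective_numbering M code \<longleftrightarrow>
     bij code \<and>
     (\<exists>g. partial_recursive g \<and> (\<forall>n. g n = Some (code (num M n)))) \<and>
     (\<exists>g. partial_recursive g \<and>
        (\<forall>ds. g (list_encode (map code ds)) = Some (code (lst M ds)))) \<and>
     (\<exists>g. partial_recursive g \<and>
        (\<forall>\<alpha>\<in>alg M. \<forall>u. g (prod_encode (code \<alpha>, code u)) = map_option code (run M \<alpha> u))) \<and>
     (\<forall>g. partial_recursive g \<longrightarrow>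
        (\<exists>\<alpha>\<in>alg M. \<forall>u. map_option code (run M \<alpha> u) = g (code u)))"

definition standard_model :: "('d, 'z) model_scheme \<Rightarrow> bool" where
  "standard_model M \<longleftrightarrow>
     inj (num M) \<and> inj (lst M) \<and>
     (\<exists>code. effective_numbering M code) \<and>
     (\<forall>d. dsize M d > 0) \<and>
     (\<forall>n. finite {d. dsize M d = n}) \<and>
     (\<forall>ds. sum_list (map (dsize M) ds) < dsize M (lst M ds)) \<and>
     (\<forall>\<alpha>\<in>alg M. \<forall>u. run M \<alpha> u \<noteq> None \<longrightarrow>
        runtime M \<alpha> u > 0 \<and>
        set (subprocs M \<alpha> u) \<subseteq> alg M \<times> UNIV \<and>
        sum_list (map (\<lambda>(\<beta>, v). runtime M \<beta> v)
          (filter (\<lambda>(\<beta>, v). run M \<beta> v \<noteq> None) (subprocs M \<alpha> u))) < runtime M \<alpha> u)"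


section \<open>Algorithmic statements, rules and libraries\<close>

definition stmt :: "('d, 'z) model_scheme \<Rightarrow> 'd \<Rightarrow> bool" where
  "stmt M s \<longleftrightarrow> (\<exists>\<alpha>\<in>alg M. \<exists>u v. s = lst M [\<alpha>, u, v])"

definition true_stmt :: "('d, 'z) model_scheme \<Rightarrow> 'd \<Rightarrow> bool" where
  "true_stmt M s \<longleftrightarrow> (\<exists>\<alpha>\<in>alg M. \<exists>u v. s = lst M [\<alpha>, u, v] \<and> run M \<alpha> u = Some v)"

definition alg_seq :: "('d, 'z) model_scheme \<Rightarrow> 'd \<Rightarrow> bool" where
  "alg_seq M \<rho> \<longleftrightarrow> \<rho> \<in> alg M \<and> (\<forall>n>0. run M \<rho> (num M n) \<noteq> None)"

definition outputs :: "('d, 'z) model_scheme \<Rightarrow> 'd \<Rightarrow> 'd list \<Rightarrow> 'd \<Rightarrow> nat \<Rightarrow> 'd list \<Rightarrow> bool" where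
  "outputs M r H \<rho> m K \<longleftrightarrow> run M r (lst M [lst M H, \<rho>, num M m]) = Some (lst M K)"

definition rule_input :: "('d, 'z) model_scheme \<Rightarrow> 'd list \<Rightarrow> 'd \<Rightarrow> nat \<Rightarrow> bool" where
  "rule_input M H \<rho> m \<longleftrightarrow> list_all (stmt M) H \<and> alg_seq M \<rho> \<and> m > 0"

definition is_rule :: "('d, 'z) model_scheme \<Rightarrow> 'd \<Rightarrow> bool" where
  "is_rule M r \<longleftrightarrow>
     r \<in> alg M \<and>
     (\<forall>H \<rho> m. rule_input M H \<rho> m \<longrightarrow>
        (\<exists>K. outputs M r H \<rho> m K \<and> list_all (stmt M) K \<and> prefix H K)) \<and>
     (\<forall>H H' \<rho> m m' K K'.
        rule_input M H \<rho> m \<and> rule_input M H' \<rho> m' \<and> m \<le> m' \<and> set H \<subseteq> set H' \<and>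
        outputs M r H \<rho> m K \<and> outputs M r H' \<rho> m' K' \<longrightarrow> set K \<subseteq> set K')"

definition seq_terms :: "('d, 'z) model_scheme \<Rightarrow> 'd \<Rightarrow> 'd set" where
  "seq_terms M \<rho> = {r. \<exists>n>0. run M \<rho> (num M n) = Some r}"

definition library :: "('d, 'z) model_scheme \<Rightarrow> 'd \<Rightarrow> bool" where
  "library M \<rho> \<longleftrightarrow> alg_seq M \<rho> \<and> (\<forall>r\<in>seq_terms M \<rho>. is_rule M r)"

definition valid_rule :: "('d, 'z) model_scheme \<Rightarrow> 'd \<Rightarrow> 'd \<Rightarrow> bool" where
  "valid_rule M \<rho> r \<longleftrightarrow>
     (\<forall>H m K. list_all (true_stmt M) H \<and> m > 0 \<and> outputs M r H \<rho> m K \<longrightarrow>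
        list_all (true_stmt M) K)"

definition valid_library :: "('d, 'z) model_scheme \<Rightarrow> 'd \<Rightarrow> bool" where
  "valid_library M \<rho> \<longleftrightarrow> library M \<rho> \<and> (\<forall>r\<in>seq_terms M \<rho>. valid_rule M \<rho> r)"


section \<open>Bases\<close>

definition base :: "('d, 'z) model_scheme \<Rightarrow> 'd set \<Rightarrow> bool" where
  "base M \<B> \<longleftrightarrow>
     (\<forall>r\<in>\<B>. is_rule M r) \<and> (finite \<B> \<or> (\<exists>\<beta>. library M \<beta> \<and> \<B> = seq_terms M \<beta>))"

definition base_library :: "('d, 'z) model_scheme \<Rightarrow> 'd set \<Rightarrow> 'd \<Rightarrow> bool" where
  "base_library M \<B> \<rho> \<longleftrightarrow> library M \<rho> \<and> \<B> \<subseteq> seq_terms M \<rho>"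

definition valid_outside :: "('d, 'z) model_scheme \<Rightarrow> 'd set \<Rightarrow> 'd \<Rightarrow> bool" where
  "valid_outside M \<B> \<rho> \<longleftrightarrow> (\<forall>r \<in> seq_terms M \<rho> - \<B>. valid_rule M \<rho> r)"

definition stable_base :: "('d, 'z) model_scheme \<Rightarrow> 'd set \<Rightarrow> bool" where
  "stable_base M \<B> \<longleftrightarrow>
     base M \<B> \<and>
     (\<forall>\<rho>. base_library M \<B> \<rho> \<and> valid_outside M \<B> \<rho> \<longrightarrow> valid_library M \<rho>)"


section \<open>Deduction\<close>

text \<open>The algorithms \<open>identity\<close> and \<open>deduce\<close> and the bijection \<open>pairing\<close> are fixed choices;
  \<open>framework\<close> below says what is required of them.\<close>

record 'd framework = "'d model" +
  identity :: 'd
  deduce :: 'd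
  pairing :: "nat \<Rightarrow> nat \<times> nat"

text \<open>\<open>H\<close> is the sequence of lists computed by \<open>deduce\<close> on \<open>[\<Gamma>, \<rho>, B]\<close>; it does not depend on
  \<open>B\<close>, which only determines when the computation stops.\<close>

definition deduction_lists ::
    "('d, 'z) framework_scheme \<Rightarrow> 'd list \<Rightarrow> 'd \<Rightarrow> (nat \<Rightarrow> 'd list) \<Rightarrow> bool" where
  "deduction_lists M \<Gamma> \<rho> H \<longleftrightarrow>
     H 0 = \<Gamma> \<and>
     (\<forall>i>0. \<forall>k m. pairing M i = (k, m) \<longrightarrow>
        (\<exists>r. run M \<rho> (num M k) = Some r \<and> outputs M r (H (i - 1)) \<rho> m (H i)))"

definition is_deduce :: "('d, 'z) framework_scheme \<Rightarrow> bool" where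
  "is_deduce M \<longleftrightarrow>
     deduce M \<in> alg M \<and>
     (\<forall>\<Gamma> \<rho> B H.
        list_all (stmt M) \<Gamma> \<and> library M \<rho> \<and> stmt M B \<and> deduction_lists M \<Gamma> \<rho> H \<longrightarrow>
        run M (deduce M) (lst M [lst M \<Gamma>, \<rho>, B]) =
          (if \<exists>i. B \<in> set (H i) then Some (num M 1) else None))"

definition framework :: "('d, 'z) framework_scheme \<Rightarrow> bool" where
  "framework M \<longleftrightarrow>
     standard_model M \<and>
     identity M \<in> alg M \<and> (\<forall>u. run M (identity M) u = Some u) \<and>
     bij_betw (pairing M) {1..} ({1..} \<times> {1..}) \<and>
     (\<exists>g. partial_recursive g \<and> (\<forall>n>0. g n = Some (prod_encode (pairing M n)))) \<and>
     is_deduce M"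

definition false_stmt :: "('d, 'z) framework_scheme \<Rightarrow> 'd" where
  "false_stmt M = lst M [identity M, num M 0, num M 1]"

definition derives :: "('d, 'z) framework_scheme \<Rightarrow> 'd \<Rightarrow> 'd list \<Rightarrow> 'd \<Rightarrow> 'd" where
  "derives M \<rho> \<Gamma> B = lst M [deduce M, lst M [lst M \<Gamma>, \<rho>, B], num M 1]"

definition imp_stmt :: "('d, 'z) framework_scheme \<Rightarrow> 'd \<Rightarrow> 'd \<Rightarrow> 'd \<Rightarrow> 'd" where
  "imp_stmt M \<rho> A B = derives M \<rho> [A] B"

definition neg_stmt :: "('d, 'z) framework_scheme \<Rightarrow> 'd \<Rightarrow> 'd \<Rightarrow> 'd" where
  "neg_stmt M \<rho> A = imp_stmt M \<rho> A (false_stmt M)"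


section \<open>Rule diagrams\<close>

text \<open>\<open>C H \<rho> m\<close> is the set of conclusions of those instances of a diagram that apply to the input
  \<open>[H, \<rho>, m]\<close>. The order and multiplicity in which these are appended to \<open>H\<close> are left open.\<close>

definition implements ::
    "('d, 'z) model_scheme \<Rightarrow> 'd \<Rightarrow> ('d list \<Rightarrow> 'd \<Rightarrow> nat \<Rightarrow> 'd set) \<Rightarrow> bool" where
  "implements M P C \<longleftrightarrow>
     P \<in> alg M \<and>
     (\<forall>H \<rho> m. rule_input M H \<rho> m \<longrightarrow>
        (\<exists>L. outputs M P H \<rho> m (H @ L) \<and> set L = C H \<rho> m))"

definition is_P1 :: "('d, 'z) framework_scheme \<Rightarrow> 'd \<Rightarrow> bool" where
  "is_P1 M P \<longleftrightarrow> implements M P (\<lambda>H \<rho> m.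
     {Y. \<exists>A. stmt M A \<and> A \<in> set H \<and> neg_stmt M \<rho> A \<in> set H \<and> Y = false_stmt M})"

definition is_P2 :: "('d, 'z) framework_scheme \<Rightarrow> 'd \<Rightarrow> bool" where
  "is_P2 M P \<longleftrightarrow> implements M P (\<lambda>H \<rho> m.
     {Y. \<exists>A B. stmt M A \<and> stmt M B \<and> A \<in> set H \<and> neg_stmt M \<rho> A \<in> set H \<and>
               dsize M B \<le> m \<and> Y = B})"

end

theory Submission imports Defs begin

text \<open>Let \<open>A\<close> be a true statement and \<open>R\<close> the rule that appends \<open>\<not>\<^sub>\<rho> A\<close> to every hypothesis list, where
  \<open>\<rho>\<close> is the nominal library. If \<open>\<rho>\<close> is a library containing \<open>R\<close> and an explosion rule \<open>P\<close>, then
  \<open>A \<turnstile>\<^sub>\<rho> \<F>\<close>: first \<open>R\<close> supplies \<open>\<not>\<^sub>\<rho> A\<close>, then \<open>P\<close> supplies \<open>\<F>\<close>. Hence \<open>\<not>\<^sub>\<rho> A\<close> is true, so \<open>R\<close> is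
  \<open>\<rho>\<close>-valid, while \<open>P\<close> leads from the true statements \<open>A\<close>, \<open>\<not>\<^sub>\<rho> A\<close> to \<open>\<F>\<close>. Adding \<open>R\<close> to the terms of a
  base containing \<open>P\<close> therefore refutes stability.\<close>

section \<open>Effective computability\<close>

text \<open>\<open>computable e f\<close>: the number \<open>f x\<close> is computable from the argument list \<open>e x\<close>, uniformly in \<open>x\<close>.
  Choosing \<open>e\<close> expresses partial functions: decoding is \<open>computable (\<lambda>n. [g n]) (\<lambda>n. n)\<close>.\<close>

definition computable :: "('a \<Rightarrow> nat list) \<Rightarrow> ('a \<Rightarrow> nat) \<Rightarrow> bool" where
  "computable e f \<longleftrightarrow> (\<exists>r. \<forall>x. rec_val r (e x) = Some (f x))"

lemma computableI: "(\<And>x. rec_val r (e x) = Some (f x)) \<Longrightarrow> computable e f"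
  unfolding computable_def by blast

lemma computable_pair_iff:
  "computable (\<lambda>(x, y). e x y) (\<lambda>(x, y). f x y) \<longleftrightarrow>
    (\<exists>r. \<forall>x y. rec_val r (e x y) = Some (f x y))"
  unfolding computable_def by simp

lemma computable_fst: "computable (\<lambda>x. f x # e x) f"
  by (rule computableI[of "Proj 0"]) simp

lemma computable_snd: "computable (\<lambda>x. g x # f x # e x) f"
  by (rule computableI[of "Proj 1"]) simp

lemma computable_const: "computable e (\<lambda>_. c)"
proof (induction c)
  case 0
  show ?case by (rule computableI[of Zero]) simp
next
  case (Suc c)
  then obtain r where "\<And>x. rec_val r (e x) = Some c"
    unfolding computable_def by blast
  then show ?case by (intro computableI[of "Comp Succ [r]"]) simp
qed

text \<open>The program for \<open>q\<close> has to work only on arguments \<open>p y\<close>, so a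
  decoder that is defined on codes alone can follow a computable map into those codes.\<close>

lemma computable_comp:
  assumes "computable (\<lambda>y. [p y]) q" "computable e (\<lambda>x. p (h x))"
  shows "computable e (\<lambda>x. q (h x))"
proof -
  obtain r s where "\<And>y. rec_val r [p y] = Some (q y)" "\<And>x. rec_val s (e x) = Some (p (h x))"
    using assms unfolding computable_def by blast
  then show ?thesis by (intro computableI[of "Comp r [s]"]) simp
qed

lemma computable_comp1:
  assumes "computable (\<lambda>y. [y]) F" "computable e f"
  shows "computable e (\<lambda>x. F (f x))"
  using computable_comp[of "\<lambda>y. y" F e f] assms by simp

lemma computable_comp2:
  assumes "computable (\<lambda>(y, z). [y, z]) (\<lambda>(y, z). F y z)" "computable e f" "computable e g"
  shows "computable e (\<lambda>x. F (f x) (g x))"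
proof -
  obtain r s t where "\<And>y z. rec_val r [y, z] = Some (F y z)"
    "\<And>x. rec_val s (e x) = Some (f x)" "\<And>x. rec_val t (e x) = Some (g x)"
    using assms unfolding computable_pair_iff unfolding computable_def by blast
  then show ?thesis by (intro computableI[of "Comp r [s, t]"]) simp
qed

text \<open>The step program has to be correct only on the value \<open>F k x\<close> that the
  recursion really reaches, so that value itself stands in its argument list.\<close>

lemma computable_rec:
  assumes "computable e (F 0)"
    and "computable (\<lambda>(k, x). k # F k x # e x) (\<lambda>(k, x). F (Suc k) x)"
  shows "computable (\<lambda>(k, x). k # e x) (\<lambda>(k, x). F k x)"
proof -
  obtain r s where r: "\<And>x. rec_val r (e x) = Some (F 0 x)"
    and s: "\<And>k x. rec_val s (k # F k x # e x) = Some (F (Suc k) x)"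
    using assms unfolding computable_pair_iff unfolding computable_def by blast
  have "rec_val (Prec r s) (k # e x) = Some (F k x)" for k x
    by (induction k) (simp_all add: r s)
  then show ?thesis by (intro computableI[of "Prec r s"]) auto
qed

text \<open>Unbounded search: \<open>t\<close> is a total test, and \<open>f x\<close> is pinned
  down as its first zero.\<close>

lemma computable_mu:
  assumes "computable (\<lambda>(k, x). k # e x) (\<lambda>(k, x). t k x)"
    and zero: "\<And>x. t (f x) x = 0" and pos: "\<And>x k. k < f x \<Longrightarrow> 0 < t k x"
  shows "computable e f"
proof -
  obtain r where r: "\<And>k x. rec_val r (k # e x) = Some (t k x)"
    using assms(1) unfolding computable_pair_iff by blast
  have "(LEAST k. t k x = 0) = f x" for x
  proof (rule Least_equality)
    show "f x \<le> k" if "t k x = 0" for k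
      using pos[of k x] that by fastforce
  qed (rule zero)
  moreover have "\<exists>n. t n x = 0 \<and> (\<forall>k<n. 0 < t k x)" for x
    using zero pos by blast
  ultimately show ?thesis by (intro computableI[of "Mu r"]) (simp add: r)
qed

section \<open>Computable arithmetic\<close>

lemma computable_Suc: "computable e f \<Longrightarrow> computable e (\<lambda>x. Suc (f x))"
  by (rule computable_comp1[of Suc]) (rule computableI[of Succ], simp)

lemma computable_add:
  "computable e f \<Longrightarrow> computable e g \<Longrightarrow> computable e (\<lambda>x. f x + g x)"
proof (rule computable_comp2[of "(+)"])
  have "computable (\<lambda>p. [fst p, fst p + snd p, snd p]) (\<lambda>p. Suc (fst p + snd p))"
    by (intro computable_Suc computable_snd)
  moreover have "computable (\<lambda>y. [y]) ((+) 0)"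
    using computable_fst[of "(+) 0" "\<lambda>_. []"] by simp
  ultimately show "computable (\<lambda>(y, z). [y, z]) (\<lambda>(y, z). y + z)"
    by (intro computable_rec[of "\<lambda>y. [y]" "(+)"]) (simp_all add: case_prod_unfold)
qed

lemma computable_pred: "computable e f \<Longrightarrow> computable e (\<lambda>x. f x - 1)"
proof (rule computable_comp1[of "\<lambda>n. n - 1"])
  \<comment> \<open>A dummy parameter of type \<open>unit\<close> with empty argument list turns
    recursion with parameters into recursion on a single argument.\<close>
  have "computable (\<lambda>(k, x :: unit). [k]) (\<lambda>(k, x). k - 1)"
    by (rule computable_rec[of "\<lambda>_. []" "\<lambda>k _. k - 1"])
      (simp_all add: computable_const computable_fst case_prod_unfold)
  then show "computable (\<lambda>y. [y]) (\<lambda>n. n - 1)"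
    unfolding computable_pair_iff unfolding computable_def by blast
qed

lemma computable_diff:
  assumes "computable e f" "computable e g"
  shows "computable e (\<lambda>x. f x - g x)"
\<comment> \<open>The recursion runs over the subtrahend, taking one predecessor per step; hence the
  exchanged arguments.\<close>
proof (rule computable_comp2[of "\<lambda>k y. y - k", OF _ assms(2,1)])
  have "computable (\<lambda>p. [fst p, snd p - fst p, snd p]) (\<lambda>p. snd p - fst p - (1 :: nat))"
    by (intro computable_pred computable_snd)
  then show "computable (\<lambda>(y, z). [y, z]) (\<lambda>(y, z). z - y)"
    by (intro computable_rec[of "\<lambda>y. [y]" "\<lambda>k y. y - k"])
      (simp_all add: computable_fst case_prod_unfold)
qed

lemma computable_if_zero:
  assumes "computable e f" "computable e g" "computable e h"
  shows "computable e (\<lambda>x. if f x = 0 then g x else h x)"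
proof -
  obtain r s t where "\<And>x. rec_val r (e x) = Some (f x)"
    "\<And>x. rec_val s (e x) = Some (g x)" "\<And>x. rec_val t (e x) = Some (h x)"
    using assms unfolding computable_def by blast
  \<comment> \<open>The base case returns \<open>b\<close>; every later step sees
    \<open>[k, z, b, c]\<close> and returns entry 3, which is \<open>c\<close>.\<close>
  moreover have "rec_val (Prec (Proj 0) (Proj 3)) [a, b, c] = Some (if a = 0 then b else c)"
    for a b c
    by (induction a) auto
  ultimately show ?thesis
    by (intro computableI[of "Comp (Prec (Proj 0) (Proj 3)) [r, s, t]"])
      (simp del: rec_val.simps(5))
qed

text \<open>Search for \<open>k\<close> with \<open>f k = f n\<close>: the two truncated differences
  add up to zero exactly at equality, and injectivity makes \<open>n\<close> the only hit.\<close>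

lemma computable_inverse:
  assumes "computable (\<lambda>n. [n]) f" "inj f"
  shows "computable (\<lambda>n. [f n]) (\<lambda>n. n)"
proof (rule computable_mu[where t = "\<lambda>k n. (f k - f n) + (f n - f k)"])
  have f: "computable (\<lambda>p. [fst p, f (snd p)]) (\<lambda>p. f (fst p))"
    by (rule computable_comp1[OF assms(1)]) (rule computable_fst)
  have "computable (\<lambda>p. [fst p, f (snd p)])
      (\<lambda>p. (f (fst p) - f (snd p)) + (f (snd p) - f (fst p)))"
    by (intro computable_add computable_diff f computable_snd)
  then show "computable (\<lambda>(k, n). [k, f n]) (\<lambda>(k, n). (f k - f n) + (f n - f k))"
    by (simp add: case_prod_unfold)
  show "0 < (f k - f n) + (f n - f k)" if "k < n" for k n
    using that assms(2) by (metis add_gr_0 injD less_irrefl linorder_neqE_nat zero_less_diff)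
qed simp


section \<open>Pairs and lists of natural numbers\<close>

lemma computable_triangle: "computable e f \<Longrightarrow> computable e (\<lambda>x. triangle (f x))"
proof (rule computable_comp1[of triangle])
  have "computable (\<lambda>p. [fst p, triangle (fst p)]) (\<lambda>p :: nat \<times> unit. triangle (fst p) + Suc (fst p))"
    by (intro computable_add computable_Suc computable_fst computable_snd)
  then have "computable (\<lambda>(k, x :: unit). [k]) (\<lambda>(k, x). triangle k)"
    by (intro computable_rec[of "\<lambda>_. []" "\<lambda>k _. triangle k"])
      (simp_all add: computable_const case_prod_unfold)
  then show "computable (\<lambda>y. [y]) triangle"
    unfolding computable_pair_iff unfolding computable_def by blast
qed

lemma computable_prod_encode:
  "computable e f \<Longrightarrow> computable e g \<Longrightarrow> computable e (\<lambda>x. prod_encode (f x, g x))"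
  by (simp add: prod_encode_def computable_add computable_triangle)

lemma triangle_prod_decode:
  "triangle (fst (prod_decode n) + snd (prod_decode n)) + fst (prod_decode n) = n"
  using prod_decode_inverse[of n] by (simp add: prod_encode_def case_prod_unfold)

text \<open>The sum of the components is the index of the diagonal containing \<open>n\<close>, that
  is, the least \<open>k\<close> with \<open>n < triangle (Suc k)\<close>; the test vanishes exactly
  under this inequality.\<close>

lemma computable_sum_prod_decode:
  "computable (\<lambda>n. [n]) (\<lambda>n. fst (prod_decode n) + snd (prod_decode n))"
proof (rule computable_mu[where t = "\<lambda>k n. Suc n - triangle (Suc k)"])
  have "computable (\<lambda>p. [fst p, snd p]) (\<lambda>p. Suc (snd p) - triangle (Suc (fst p)))"
    by (intro computable_diff computable_triangle computable_Suc computable_fst computable_snd)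
  then show "computable (\<lambda>(k, n). [k, n]) (\<lambda>(k, n). Suc n - triangle (Suc k))"
    by (simp add: case_prod_unfold)
  show "Suc n - triangle (Suc (fst (prod_decode n) + snd (prod_decode n))) = 0" for n
    using triangle_prod_decode[of n] by simp
  have mono: "j \<le> k \<Longrightarrow> triangle j \<le> triangle k" for j k
    by (rule lift_Suc_mono_le[of triangle]) auto
  show "0 < Suc n - triangle (Suc k)" if "k < fst (prod_decode n) + snd (prod_decode n)" for k n
    using mono[of "Suc k" "fst (prod_decode n) + snd (prod_decode n)"] that triangle_prod_decode[of n]
    by linarith
qed

lemma computable_fst_prod_decode:
  assumes "computable e f"
  shows "computable e (\<lambda>x. fst (prod_decode (f x)))"
proof -
  have "f x - triangle (fst (prod_decode (f x)) + snd (prod_decode (f x))) = fst (prod_decode (f x))"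
    for x
    using triangle_prod_decode[of "f x"] by linarith
  then show ?thesis
    using computable_diff[OF assms
        computable_triangle[OF computable_comp1[OF computable_sum_prod_decode assms]]] by simp
qed

lemma computable_snd_prod_decode:
  assumes "computable e f"
  shows "computable e (\<lambda>x. snd (prod_decode (f x)))"
  using computable_diff[OF computable_comp1[OF computable_sum_prod_decode assms]
      computable_fst_prod_decode[OF assms]]
  by simp

section \<open>Operations on encoded lists\<close>

lemma computable_Cons:
  "computable e f \<Longrightarrow> computable e (\<lambda>x. list_encode (g x)) \<Longrightarrow>
    computable e (\<lambda>x. list_encode (f x # g x))"
  by (simp add: computable_Suc computable_prod_encode)

lemma computable_Nil: "computable e (\<lambda>x. list_encode [])"
  by (rule computable_const)

lemma computable_hd:
  assumes "computable e (\<lambda>x. list_encode (f x # g x))"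
  shows "computable e f"
  using computable_fst_prod_decode[OF computable_pred[OF assms]] by simp

lemma computable_tl:
  assumes "computable e (\<lambda>x. list_encode (f x # g x))"
  shows "computable e (\<lambda>x. list_encode (g x))"
  using computable_snd_prod_decode[OF computable_pred[OF assms]] by simp

text \<open>One step of reversal onto an accumulator. It does nothing once the first list is empty,
  so surplus iterations are harmless.\<close>

fun move :: "'a list \<times> 'a list \<Rightarrow> 'a list \<times> 'a list" where
  "move ([], ys) = ([], ys)"
| "move (x # xs, ys) = (xs, x # ys)"

lemma move_funpow: "length xs \<le> k \<Longrightarrow> (move ^^ k) (xs, ys) = ([], rev xs @ ys)"
proof (induction k arbitrary: xs ys)
  case (Suc k)
  then show ?case by (cases xs) (simp_all add: funpow_Suc_right del: funpow.simps)
qed simp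

text \<open>Lets the code of a list serve as the number of iterations of \<open>move\<close>, so
  that no length has to be computed.\<close>

lemma length_le_list_encode: "length xs \<le> list_encode xs"
proof (induction xs)
  case (Cons x xs)
  then show ?case using le_prod_encode_2[of "list_encode xs" x] by simp
qed simp

lemma computable_revappend:
  assumes "computable e (\<lambda>x. list_encode (f x))" "computable e (\<lambda>x. list_encode (g x))"
  shows "computable e (\<lambda>x. list_encode (rev (f x) @ g x))"
proof -
  define st where "st p = prod_encode (list_encode (fst p), list_encode (snd p))"
    for p :: "nat list \<times> nat list"
  \<comment> \<open>On codes, the first list is empty iff its code is 0; otherwise the code minus
    one is the pair of the head and the code of the tail.\<close>
  have st_move: "st (move p) =
    (if fst (prod_decode (st p)) = 0 then st p
     else prod_encode (snd (prod_decode (fst (prod_decode (st p)) - 1)),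
       Suc (prod_encode (fst (prod_decode (fst (prod_decode (st p)) - 1)),
         snd (prod_decode (st p))))))" for p
    by (cases p rule: move.cases) (simp_all add: st_def)
  have "computable (\<lambda>p. [fst p, st ((move ^^ fst p) (snd p)), st (snd p)])
    (\<lambda>p. st (move ((move ^^ fst p) (snd p))))"
    unfolding st_move
    by (intro computable_if_zero computable_prod_encode computable_Suc
        computable_fst_prod_decode computable_snd_prod_decode computable_pred computable_snd)
  then have "computable (\<lambda>(k, p). [k, st p]) (\<lambda>(k, p). st ((move ^^ k) p))"
    by (intro computable_rec[of "\<lambda>p. [st p]" "\<lambda>k p. st ((move ^^ k) p)"])
      (simp_all add: computable_fst case_prod_unfold)
  then obtain r where r: "\<And>k p. rec_val r [k, st p] = Some (st ((move ^^ k) p))"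
    unfolding computable_pair_iff by blast
  obtain s where s: "\<And>x. rec_val s (e x) = Some (list_encode (f x))"
    using assms(1) unfolding computable_def by blast
  obtain t where t: "\<And>x. rec_val t (e x) = Some (st (f x, g x))"
    using computable_prod_encode[OF assms] unfolding computable_def st_def by auto
  have "computable e (\<lambda>x. st ([], rev (f x) @ g x))"
    by (rule computableI[of "Comp r [s, t]"])
      (simp add: r s t move_funpow length_le_list_encode)
  from computable_snd_prod_decode[OF this] show ?thesis by (simp add: st_def)
qed

text \<open>Two reversals: the first onto the empty list, the second onto the one new entry.\<close>

lemma computable_snoc:
  assumes "computable e (\<lambda>x. list_encode (f x))" "computable e g"
  shows "computable e (\<lambda>x. list_encode (f x @ [g x]))"
  using computable_revappend[OF computable_revappend[OF assms(1) computable_Nil]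
      computable_Cons[OF assms(2) computable_Nil]]
  by simp


section \<open>Algorithms of a standard model\<close>

lemma computable_of_partial_recursive:
  assumes "\<exists>g. partial_recursive g \<and> (\<forall>x. g (p x) = Some (q x))"
  shows "computable (\<lambda>x. [p x]) q"
  using assms unfolding partial_recursive_def computable_def by metis

locale numbered_model =
  fixes M :: "('d, 'z) model_scheme" and code :: "'d \<Rightarrow> nat"
  assumes inj_num: "inj (num M)" and inj_lst: "inj (lst M)"
    and numbering: "effective_numbering M code"
begin

lemma inj_code: "inj code"
  using numbering unfolding effective_numbering_def by (simp add: bij_def)

lemma lst_eq_iff [simp]: "lst M xs = lst M ys \<longleftrightarrow> xs = ys"
  using inj_lst by (simp add: inj_eq)

lemma computable_num:
  "computable e f \<Longrightarrow> computable e (\<lambda>x. code (num M (f x)))"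
proof (rule computable_comp1[of "\<lambda>n. code (num M n)"])
  show "computable (\<lambda>n. [n]) (\<lambda>n. code (num M n))"
    using numbering unfolding effective_numbering_def
    by (elim conjE) (rule computable_of_partial_recursive)
qed

text \<open>Numerals are formed effectively and injectively, so the number is recovered by
  search.\<close>

lemma computable_num_inverse:
  "computable e (\<lambda>x. code (num M (f x))) \<Longrightarrow> computable e f"
proof (rule computable_comp)
  show "computable (\<lambda>n. [code (num M n)]) (\<lambda>n. n)"
    by (rule computable_inverse)
      (auto intro: computable_num computable_fst inj_compose[OF inj_code inj_num, unfolded comp_def])
qed

lemma computable_lst:
  "computable e (\<lambda>x. list_encode (map code (f x))) \<Longrightarrow> computable e (\<lambda>x. code (lst M (f x)))"
proof (rule computable_comp[of "\<lambda>ds. list_encode (map code ds)" "\<lambda>ds. code (lst M ds)"])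
  show "computable (\<lambda>ds. [list_encode (map code ds)]) (\<lambda>ds. code (lst M ds))"
    using numbering unfolding effective_numbering_def
    by (elim conjE) (rule computable_of_partial_recursive)
qed

text \<open>Search again. As it runs over numbers, the lists of data are first indexed by numbers
  through \<open>g\<close>, which is possible because \<open>code\<close> is bijective.\<close>

lemma computable_lst_inverse:
  assumes "computable e (\<lambda>x. code (lst M (f x)))"
  shows "computable e (\<lambda>x. list_encode (map code (f x)))"
proof -
  define g where "g n = map (inv code) (list_decode n)" for n
  have bij: "bij code"
    using numbering unfolding effective_numbering_def by blast
  have g: "list_encode (map code (g n)) = n" for n
    using bij by (simp add: g_def comp_def bij_is_surj surj_f_inv_f)
  have g': "g (list_encode (map code ds)) = ds" for ds
    using bij by (simp add: g_def comp_def bij_is_inj)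
  have "inj (\<lambda>n. code (lst M (g n)))"
    by (rule injI) (metis g injD inj_code inj_lst)
  then have "computable (\<lambda>n. [code (lst M (g n))]) (\<lambda>n. n)"
    by (intro computable_inverse computable_lst) (auto simp: g intro: computable_fst)
  then show ?thesis
    by (rule computable_comp[where h = "\<lambda>x. list_encode (map code (f x))"])
      (simp add: g' assms)
qed

lemma computable_run:
  assumes "\<alpha> \<in> alg M" "\<And>x. run M \<alpha> (f x) = Some (g x)" "computable e (\<lambda>x. code (f x))"
  shows "computable e (\<lambda>x. code (g x))"
proof -
  obtain h where "partial_recursive h"
    "\<And>u. h (prod_encode (code \<alpha>, code u)) = map_option code (run M \<alpha> u)"
    using numbering assms(1) unfolding effective_numbering_def by blast
  then have "computable (\<lambda>x. [prod_encode (code \<alpha>, code (f x))]) (\<lambda>x. code (g x))"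
    using assms(2) by (intro computable_of_partial_recursive) auto
  then show ?thesis
    by (rule computable_comp[where h = "\<lambda>x. x"])
      (intro computable_prod_encode computable_const assms(3))
qed

text \<open>The behaviour is prescribed only on inputs of the form \<open>f x\<close>, so
  \<open>f\<close> can describe the well-formed inputs of the algorithm wanted.\<close>

lemma algorithm_exists:
  assumes "computable (\<lambda>x. [code (f x)]) (\<lambda>x. code (g x))"
  shows "\<exists>\<alpha>\<in>alg M. \<forall>x. run M \<alpha> (f x) = Some (g x)"
proof -
  obtain r where r: "\<And>x. rec_val r [code (f x)] = Some (code (g x))"
    using assms unfolding computable_def by blast
  have "partial_recursive (\<lambda>n. rec_val r [n])"
    unfolding partial_recursive_def by blast
  then obtain \<alpha> where \<alpha>: "\<alpha> \<in> alg M" "\<And>u. map_option code (run M \<alpha> u) = rec_val r [code u]"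
    using numbering unfolding effective_numbering_def by metis
  have "run M \<alpha> (f x) = Some (g x)" for x
    using \<alpha>(2)[of "f x"] r[of x] by (auto simp: inj_eq[OF inj_code])
  with \<alpha>(1) show ?thesis by blast
qed

section \<open>Enumerable sets of data and libraries\<close>

definition enumerable :: "'d set \<Rightarrow> bool" where
  "enumerable S \<longleftrightarrow> (\<exists>h :: nat \<Rightarrow> 'd. computable (\<lambda>n. [n]) (\<lambda>n. code (h n)) \<and> range h = S)"

lemma enumerable_singleton: "enumerable {x}"
  unfolding enumerable_def by (intro exI[of _ "\<lambda>_. x"]) (auto intro: computable_const)

lemma enumerable_insert:
  assumes "enumerable S"
  shows "enumerable (insert x S)"
proof -
  obtain h :: "nat \<Rightarrow> 'd" where h: "computable (\<lambda>n. [n]) (\<lambda>n. code (h n))" "range h = S"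
    using assms unfolding enumerable_def by blast
  \<comment> \<open>Both branches are evaluated; at \<open>n = 0\<close> truncated subtraction lets
    the second one read \<open>h 0\<close>.\<close>
  have "computable (\<lambda>n. [n]) (\<lambda>n. if n = 0 then code x else code (h (n - 1)))"
    by (intro computable_if_zero computable_const computable_pred
        computable_comp1[OF h(1), of _ "\<lambda>n. n - 1"]) (auto intro: computable_fst)
  moreover have "(\<lambda>n. if n = 0 then code x else code (h (n - 1))) =
      (\<lambda>n. code (case n of 0 \<Rightarrow> x | Suc k \<Rightarrow> h k))"
    by (auto split: nat.splits)
  moreover have "range (case_nat x h) = insert x S"
    using h(2) by (auto simp: image_iff split: nat.splits)
  ultimately show ?thesis unfolding enumerable_def by (intro exI[of _ "case_nat x h"]) simp
qed

text \<open>An enumerable set is the range of a total function on the natural numbers, hence the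
  condition of nonemptiness.\<close>

lemma enumerable_finite: "finite S \<Longrightarrow> S \<noteq> {} \<Longrightarrow> enumerable S"
  by (induction S rule: finite_ne_induct) (auto intro: enumerable_singleton enumerable_insert)

lemma enumerable_seq_terms:
  assumes "alg_seq M \<rho>"
  shows "enumerable (seq_terms M \<rho>)"
proof -
  \<comment> \<open>Sequences are indexed from 1 and enumerations from 0. The run halts at every
    positive index, so \<open>the\<close> is applied to a genuine value.\<close>
  define h where "h n = the (run M \<rho> (num M (Suc n)))" for n
  have h: "run M \<rho> (num M (Suc n)) = Some (h n)" for n
    using assms unfolding alg_seq_def h_def by auto
  have "computable (\<lambda>n. [n]) (\<lambda>n. code (h n))"
  proof (rule computable_run)
    show "\<rho> \<in> alg M" using assms unfolding alg_seq_def by blast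
    show "computable (\<lambda>n. [n]) (\<lambda>n. code (num M (Suc n)))"
      by (intro computable_num computable_Suc computable_fst)
  qed (rule h)
  moreover have "range h = seq_terms M \<rho>"
    unfolding seq_terms_def using h by (auto simp: image_iff) (metis Suc_pred option.inject)
  ultimately show ?thesis unfolding enumerable_def by blast
qed

lemma seq_of_enumerable:
  assumes "enumerable S"
  shows "\<exists>\<rho>. alg_seq M \<rho> \<and> seq_terms M \<rho> = S"
proof -
  obtain h :: "nat \<Rightarrow> 'd" where h: "computable (\<lambda>n. [n]) (\<lambda>n. code (h n))" "range h = S"
    using assms unfolding enumerable_def by blast
  have "computable (\<lambda>n. [code (num M n)]) (\<lambda>n. n)"
    by (rule computable_num_inverse) (rule computable_fst)
  then have "computable (\<lambda>n. [code (num M n)]) (\<lambda>n. code (h (n - 1)))"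
    by (intro computable_comp1[OF h(1), of _ "\<lambda>n. n - 1"] computable_pred)
  then obtain \<rho> where "\<rho> \<in> alg M" "\<And>n. run M \<rho> (num M n) = Some (h (n - 1))"
    using algorithm_exists[of "num M" "\<lambda>n. h (n - 1)"] by blast
  moreover from this have "seq_terms M \<rho> = S"
    unfolding seq_terms_def h(2)[symmetric] by (auto simp: image_iff)
  ultimately show ?thesis unfolding alg_seq_def by auto
qed

text \<open>Supplies a library over the base in which \<open>R\<close> is the only term that can lie
  outside it.\<close>

lemma library_insert_base:
  assumes "base M \<B>" "is_rule M R"
  shows "\<exists>\<rho>. library M \<rho> \<and> seq_terms M \<rho> = insert R \<B>"
proof -
  \<comment> \<open>A finite base, even an empty one, becomes finite and nonempty; the terms of a
    library are already enumerable and gain one element.\<close>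
  have "enumerable (insert R \<B>)"
    using assms(1) unfolding base_def library_def
    by (auto intro: enumerable_finite enumerable_insert enumerable_seq_terms)
  then obtain \<rho> where "alg_seq M \<rho>" "seq_terms M \<rho> = insert R \<B>"
    using seq_of_enumerable by blast
  moreover have "\<forall>r\<in>insert R \<B>. is_rule M r"
    using assms unfolding base_def by (elim conjE) simp
  ultimately show ?thesis
    unfolding library_def by (intro exI[of _ \<rho>]) simp
qed

end


section \<open>Deductions\<close>

lemma framework_numbered_model:
  assumes "framework M"
  obtains code where "numbered_model M code"
  using assms unfolding framework_def standard_model_def numbered_model_def by blast

lemma framework_lst_eq_iff:
  "framework M \<Longrightarrow> lst M xs = lst M ys \<longleftrightarrow> xs = ys"
  unfolding framework_def standard_model_def by (simp add: inj_eq)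

lemma is_rule_output:
  "is_rule M r \<Longrightarrow> rule_input M H \<rho> m \<Longrightarrow>
    \<exists>K. outputs M r H \<rho> m K \<and> list_all (stmt M) K \<and> prefix H K"
  unfolding is_rule_def by (elim conjE) simp

lemma outputs_unique:
  "framework M \<Longrightarrow> outputs M r H \<rho> m K \<Longrightarrow> outputs M r H \<rho> m K' \<Longrightarrow> K = K'"
  unfolding outputs_def by (simp add: framework_lst_eq_iff)

lemma false_stmt_not_true:
  assumes "framework M"
  shows "\<not> true_stmt M (false_stmt M)"
proof -
  have "num M 0 \<noteq> num M 1"
    using assms unfolding framework_def standard_model_def by (metis injD zero_neq_one)
  then show ?thesis
    using assms unfolding true_stmt_def false_stmt_def
    by (auto simp: framework_lst_eq_iff framework_def)
qed

lemma stmt_false_stmt: "framework M \<Longrightarrow> stmt M (false_stmt M)"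
  unfolding stmt_def false_stmt_def framework_def by blast

lemma stmt_neg_stmt: "framework M \<Longrightarrow> stmt M (neg_stmt M \<rho> A)"
  unfolding stmt_def neg_stmt_def imp_stmt_def derives_def framework_def is_deduce_def by blast

lemma true_stmt_imp_stmt: "true_stmt M A \<Longrightarrow> stmt M A"
  unfolding true_stmt_def stmt_def by blast

text \<open>\<open>is_deduce\<close> speaks about a given sequence of lists, so one must be built.
  Each rule halts on the list so far and returns statements again, so the result is a legitimate
  input for the next rule.\<close>

lemma deduction_exists:
  assumes "framework M" "library M \<rho>" "list_all (stmt M) \<Gamma>"
  obtains H where "deduction_lists M \<Gamma> \<rho> H" "\<And>i. list_all (stmt M) (H i)"
    "\<And>i. prefix (H i) (H (Suc i))"
proof -
  let ?step = "\<lambda>i X Y. (\<forall>k m. pairing M (Suc i) = (k, m) \<longrightarrow>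
    (\<exists>r. run M \<rho> (num M k) = Some r \<and> outputs M r X \<rho> m Y)) \<and> prefix X Y"
  \<comment> \<open>The conjunct with \<open>Suc i = 0\<close> is vacuous; it gives the claim the
    shape of the invariant for dependent choice, which fixes the list at index 0.\<close>
  have step: "\<exists>Y. (list_all (stmt M) Y \<and> (Suc i = 0 \<longrightarrow> Y = \<Gamma>)) \<and> ?step i X Y"
    if X: "list_all (stmt M) X \<and> (i = 0 \<longrightarrow> X = \<Gamma>)" for X i
  proof -
    obtain k m where km: "pairing M (Suc i) = (k, m)" by fastforce
    have "bij_betw (pairing M) {1..} ({1..} \<times> {1..})"
      using assms(1) unfolding framework_def by blast
    then have "pairing M (Suc i) \<in> {1..} \<times> {1..}"
      by (rule bij_betwE[THEN bspec]) simp
    then have pos: "0 < k" "0 < m" using km by auto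
    have "run M \<rho> (num M k) \<noteq> None"
      using assms(2) pos(1) unfolding library_def alg_seq_def by (elim conjE) simp
    then obtain r where r: "run M \<rho> (num M k) = Some r" by blast
    then have "r \<in> seq_terms M \<rho>"
      using pos(1) unfolding seq_terms_def by blast
    then have rule: "is_rule M r"
      using assms(2) unfolding library_def by (elim conjE) (rule bspec)
    have input: "rule_input M X \<rho> m"
      using X pos assms(2) unfolding rule_input_def library_def by (elim conjE) simp
    obtain Y where "outputs M r X \<rho> m Y" "list_all (stmt M) Y" "prefix X Y"
      using is_rule_output[OF rule input] by blast
    with r km show ?thesis by (intro exI[of _ Y]) simp
  qed
  have "\<exists>H. \<forall>i. (list_all (stmt M) (H i) \<and> (i = 0 \<longrightarrow> H i = \<Gamma>)) \<and> ?step i (H i) (H (Suc i))"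
    by (rule dependent_nat_choice[where P = "\<lambda>i X. list_all (stmt M) X \<and> (i = 0 \<longrightarrow> X = \<Gamma>)"])
      (use assms(3) step in auto)
  then obtain H where H: "\<And>i. list_all (stmt M) (H i)" "H 0 = \<Gamma>"
    "\<And>i. ?step i (H i) (H (Suc i))" by blast
  have "deduction_lists M \<Gamma> \<rho> H"
    unfolding deduction_lists_def using H(2,3) by (metis Suc_pred' diff_Suc_1)
  with H show thesis by (intro that) auto
qed

text \<open>Infinitely many resource integers are paired with \<open>k\<close>, while the stages up
  to \<open>i\<^sub>0\<close> use only finitely many; a fresh large one must occur later.\<close>

lemma late_stage:
  assumes "framework M" "0 < k"
  obtains i m where "i\<^sub>0 < i" "pairing M i = (k, m)" "m\<^sub>0 < m"
proof -
  have bij: "bij_betw (pairing M) {1..} ({1..} \<times> {1..})"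
    using assms(1) unfolding framework_def by blast
  have "infinite ({m\<^sub>0<..} - snd ` pairing M ` {..i\<^sub>0})"
    by (rule Diff_infinite_finite) (auto simp: infinite_Ioi)
  then obtain m where m: "m\<^sub>0 < m" "m \<notin> snd ` pairing M ` {..i\<^sub>0}"
    by (metis DiffD1 DiffD2 equals0I finite.emptyI greaterThan_iff)
  then have "(k, m) \<in> pairing M ` {1..}"
    using assms(2) bij unfolding bij_betw_def by auto
  then obtain i where i: "pairing M i = (k, m)" by auto
  with m have "i\<^sub>0 < i" by (metis atMost_iff image_eqI linorder_not_le snd_conv)
  with i m show thesis by (intro that)
qed

text \<open>Fairness of the schedule: every rule of the library is applied arbitrarily late with
  arbitrarily large resources.\<close>

lemma deduction_stage:
  assumes "framework M" "library M \<rho>" "deduction_lists M \<Gamma> \<rho> H" "r \<in> seq_terms M \<rho>"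
  obtains i m where "i\<^sub>0 < i" "m\<^sub>0 < m" "outputs M r (H (i - 1)) \<rho> m (H i)"
proof -
  obtain k where k: "0 < k" "run M \<rho> (num M k) = Some r"
    using assms(4) unfolding seq_terms_def by blast
  obtain i m where i: "i\<^sub>0 < i" "pairing M i = (k, m)" "m\<^sub>0 < m"
    using late_stage[OF assms(1) k(1)] .
  have "0 < i" using i(1) by simp
  then obtain r' where "run M \<rho> (num M k) = Some r'" "outputs M r' (H (i - 1)) \<rho> m (H i)"
    using assms(3) i(2) unfolding deduction_lists_def by blast
  then have "outputs M r (H (i - 1)) \<rho> m (H i)" using k(2) by simp
  with i(1,3) show thesis by (rule that)
qed

lemma true_derivesI:
  assumes "framework M" "library M \<rho>" "list_all (stmt M) \<Gamma>" "stmt M B"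
    and "deduction_lists M \<Gamma> \<rho> H" "B \<in> set (H i)"
  shows "true_stmt M (derives M \<rho> \<Gamma> B)"
proof -
  have deduce: "is_deduce M"
    using assms(1) unfolding framework_def by (elim conjE)
  have "run M (deduce M) (lst M [lst M \<Gamma>, \<rho>, B]) =
      (if \<exists>i. B \<in> set (H i) then Some (num M 1) else None)"
    using deduce[unfolded is_deduce_def, THEN conjunct2, rule_format, of \<Gamma> \<rho> B H] assms(2-5)
    by simp
  then have "run M (deduce M) (lst M [lst M \<Gamma>, \<rho>, B]) = Some (num M 1)"
    using assms(6) by auto
  then show ?thesis
    using deduce unfolding true_stmt_def derives_def is_deduce_def by blast
qed


section \<open>Explosion rules\<close>

lemma implements_output:
  assumes "framework M" "implements M P C" "rule_input M H \<rho> m" "outputs M P H \<rho> m K"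
  shows "C H \<rho> m \<subseteq> set K"
proof -
  obtain L where L: "outputs M P H \<rho> m (H @ L)" "set L = C H \<rho> m"
    using assms(2,3) unfolding implements_def by blast
  then have "K = H @ L" using outputs_unique[OF assms(1,4)] by blast
  with L(2) show ?thesis by simp
qed

text \<open>Lets both rules be treated alike: for \<open>P2\<close> the instance with
  \<open>B\<close> the false statement is taken, which is allowed by the bound on
  \<open>m\<close>.\<close>

lemma explosion_output:
  assumes "framework M" "is_P1 M P \<or> is_P2 M P" "rule_input M H \<rho> m"
    and "dsize M (false_stmt M) \<le> m"
    and "A \<in> set H" "neg_stmt M \<rho> A \<in> set H" "outputs M P H \<rho> m K"
  shows "false_stmt M \<in> set K"
proof -
  have A: "stmt M A"
    using assms(3,5) unfolding rule_input_def by (simp add: list_all_iff)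
  show ?thesis
    using assms(2)
  proof
    assume "is_P1 M P"
    then show ?thesis
      using implements_output[OF assms(1) _ assms(3,7)] A assms(5,6) unfolding is_P1_def by blast
  next
    assume "is_P2 M P"
    then show ?thesis
      using implements_output[OF assms(1) _ assms(3,7)] A assms(4-6) stmt_false_stmt[OF assms(1)]
      unfolding is_P2_def by blast
  qed
qed

lemma explosion_not_valid:
  assumes "framework M" "is_P1 M P \<or> is_P2 M P" "alg_seq M \<rho>"
    and "true_stmt M A" "true_stmt M (neg_stmt M \<rho> A)" "is_rule M P"
  shows "\<not> valid_rule M \<rho> P"
proof
  assume valid: "valid_rule M \<rho> P"
  define m where "m = Suc (dsize M (false_stmt M))"
  have input: "rule_input M [A, neg_stmt M \<rho> A] \<rho> m"
    using assms(3-5) true_stmt_imp_stmt unfolding rule_input_def m_def by auto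
  then obtain K where K: "outputs M P [A, neg_stmt M \<rho> A] \<rho> m K"
    using is_rule_output[OF assms(6)] by blast
  then have "list_all (true_stmt M) K"
    using valid[unfolded valid_rule_def, rule_format, of "[A, neg_stmt M \<rho> A]" m K] assms(4,5)
    by (simp add: m_def)
  moreover have "false_stmt M \<in> set K"
    using explosion_output[OF assms(1,2) input _ _ _ K] by (auto simp: m_def)
  ultimately show False
    using false_stmt_not_true[OF assms(1)] by (auto simp: list_all_iff)
qed

text \<open>Since the nominal library is part of the input, no fixed point construction is needed for
  a rule that speaks about the library containing it.\<close>

lemma negation_rule_exists:
  assumes "framework M"
  obtains R where "is_rule M R"
    "\<And>H \<rho> m. outputs M R H \<rho> m (H @ [neg_stmt M \<rho> A])"
proof -
  obtain code where "numbered_model M code"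
    using framework_numbered_model[OF assms] .
  then interpret numbered_model M code .
  \<comment> \<open>\<open>R\<close> is specified on all triples of a list, a datum and a number,
    whether or not they form a rule input.\<close>
  let ?in = "\<lambda>(H, \<rho>, m). lst M [lst M H, \<rho>, num M m]"
  let ?out = "\<lambda>(H, \<rho>, m). lst M (H @ [neg_stmt M \<rho> A])"
  let ?e = "\<lambda>x. [code (?in x)]"
  have "computable ?e (\<lambda>x. code (lst M [lst M (fst x), fst (snd x), num M (snd (snd x))]))"
    by (simp add: case_prod_unfold computable_fst)
  from computable_lst_inverse[OF this] have input: "computable ?e (\<lambda>x. list_encode
    (code (lst M (fst x)) # code (fst (snd x)) # [code (num M (snd (snd x)))]))"
    by simp
  have H: "computable ?e (\<lambda>x. list_encode (map code (fst x)))"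
    using computable_lst_inverse[OF computable_hd[OF input]] .
  have \<rho>: "computable ?e (\<lambda>x. code (fst (snd x)))"
    using computable_hd[OF computable_tl[OF input]] .
  \<comment> \<open>The negation is a nest of lists whose only varying entry is the nominal
    library.\<close>
  have neg: "computable ?e (\<lambda>x. code (neg_stmt M (fst (snd x)) A))"
    unfolding neg_stmt_def imp_stmt_def derives_def
    by (intro computable_lst, unfold list.map)
      (intro computable_Cons computable_Nil computable_const computable_lst,
        unfold list.map, intro computable_Cons computable_Nil computable_const \<rho>)
  have "computable ?e (\<lambda>x. code (lst M (fst x @ [neg_stmt M (fst (snd x)) A])))"
    using computable_snoc[OF H neg] by (intro computable_lst) simp
  then have "computable ?e (\<lambda>x. code (?out x))"
    by (simp add: case_prod_unfold)
  then obtain R where R: "R \<in> alg M" "\<And>x. run M R (?in x) = Some (?out x)"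
    using algorithm_exists[of ?in ?out] by blast
  have out: "outputs M R H \<rho> m (H @ [neg_stmt M \<rho> A])" for H \<rho> m
    using R(2)[of "(H, \<rho>, m)"] unfolding outputs_def by simp
  have unique: "K = H @ [neg_stmt M \<rho> A]" if "outputs M R H \<rho> m K" for H \<rho> m K
    using outputs_unique[OF assms that out] .
  have "is_rule M R"
    unfolding is_rule_def
  proof (intro conjI allI impI)
    show "\<exists>K. outputs M R H \<rho> m K \<and> list_all (stmt M) K \<and> prefix H K"
      if "rule_input M H \<rho> m" for H \<rho> m
      using that out[of H \<rho> m] stmt_neg_stmt[OF assms] unfolding rule_input_def
      by (intro exI[of _ "H @ [neg_stmt M \<rho> A]"]) auto
    show "set K \<subseteq> set K'"
      if *: "rule_input M H \<rho> m \<and> rule_input M H' \<rho> m' \<and> m \<le> m' \<and> set H \<subseteq> set H' \<and>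
        outputs M R H \<rho> m K \<and> outputs M R H' \<rho> m' K'" for H H' \<rho> m m' K K'
    proof -
      \<comment> \<open>Monotonicity compares outputs for the same nominal library, so both append
        the same statement.\<close>
      have "K = H @ [neg_stmt M \<rho> A]" "K' = H' @ [neg_stmt M \<rho> A]"
        using * unique by blast+
      with * show ?thesis by auto
    qed
  qed (rule R(1))
  then show thesis using out by (rule that)
qed

text \<open>The truth of the negation is a fact about what \<open>deduce\<close> finds, so validity
  of the rules in \<rho> is nowhere assumed and there is no circularity. Other rules only lengthen
  the lists and cannot remove a premise.\<close>

lemma neg_stmt_true:
  assumes "framework M" "library M \<rho>" "stmt M A"
    and P: "is_P1 M P \<or> is_P2 M P" "P \<in> seq_terms M \<rho>"
    and R: "R \<in> seq_terms M \<rho>" "\<And>H m. outputs M R H \<rho> m (H @ [neg_stmt M \<rho> A])"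
  shows "true_stmt M (neg_stmt M \<rho> A)"
proof -
  have \<Gamma>: "list_all (stmt M) [A]" using assms(3) by simp
  obtain H where H: "deduction_lists M [A] \<rho> H" "\<And>i. list_all (stmt M) (H i)"
    "\<And>i. prefix (H i) (H (Suc i))"
    using deduction_exists[OF assms(1,2) \<Gamma>] by blast
  have mono: "set (H i) \<subseteq> set (H j)" if "i \<le> j" for i j
    using lift_Suc_mono_le[of "\<lambda>i. set (H i)", OF _ that] set_mono_prefix[OF H(3)] by blast
  have "A \<in> set (H 0)"
    using H(1) unfolding deduction_lists_def by simp
  obtain i m where i: "0 < i" "outputs M R (H (i - 1)) \<rho> m (H i)"
    using deduction_stage[OF assms(1,2) H(1) R(1), of 0 0] by blast
  have neg: "neg_stmt M \<rho> A \<in> set (H i)"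
    using outputs_unique[OF assms(1) i(2) R(2)] by simp
  \<comment> \<open>\<open>P\<close> must act strictly after stage \<open>i\<close>, so that its
    input \<open>H (j - 1)\<close> already carries the negation, and with resources covering the
    size of the false statement.\<close>
  obtain j n where j: "i < j" "dsize M (false_stmt M) < n" "outputs M P (H (j - 1)) \<rho> n (H j)"
    using deduction_stage[OF assms(1,2) H(1) P(2)] by blast
  have "rule_input M (H (j - 1)) \<rho> n"
    using H(2) assms(2) j(2) unfolding rule_input_def library_def by auto
  moreover have i_le: "i \<le> j - 1"
    using j(1) by simp
  moreover have "A \<in> set (H (j - 1))" "neg_stmt M \<rho> A \<in> set (H (j - 1))"
    using mono[of 0 "j - 1"] mono[OF i_le] \<open>A \<in> set (H 0)\<close> neg by blast+
  ultimately have "false_stmt M \<in> set (H j)"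
    using explosion_output[OF assms(1) P(1)] j(2,3) by auto
  then show ?thesis
    unfolding neg_stmt_def imp_stmt_def
    using true_derivesI[OF assms(1,2) \<Gamma> stmt_false_stmt[OF assms(1)] H(1)] by blast
qed

theorem corollary14p3:
  fixes M :: "'d framework"
  assumes "framework M"
  shows "\<not> (\<exists>\<B>. stable_base M \<B> \<and> (\<exists>P\<in>\<B>. is_P1 M P \<or> is_P2 M P))"
proof
  assume "\<exists>\<B>. stable_base M \<B> \<and> (\<exists>P\<in>\<B>. is_P1 M P \<or> is_P2 M P)"
  then obtain \<B> P where \<B>: "stable_base M \<B>" and P: "P \<in> \<B>" "is_P1 M P \<or> is_P2 M P"
    by blast
  then have base: "base M \<B>" unfolding stable_base_def by blast
  \<comment> \<open>A concrete true statement: \<open>identity\<close> maps 0 to 0.\<close>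
  define A where "A = lst M [identity M, num M 0, num M 0]"
  have A: "true_stmt M A"
    using assms unfolding true_stmt_def A_def framework_def by blast
  obtain R where R: "is_rule M R" "\<And>H \<rho> m. outputs M R H \<rho> m (H @ [neg_stmt M \<rho> A])"
    using negation_rule_exists[OF assms] by blast
  obtain code where code: "numbered_model M code"
    using framework_numbered_model[OF assms] .
  obtain \<rho> where \<rho>: "library M \<rho>" "seq_terms M \<rho> = insert R \<B>"
    using numbered_model.library_insert_base[OF code base R(1)] by blast
  have neg: "true_stmt M (neg_stmt M \<rho> A)"
    using neg_stmt_true[OF assms \<rho>(1) true_stmt_imp_stmt[OF A] P(2) _ _ R(2)] P(1) \<rho>(2) by blast
  have "list_all (true_stmt M) K" if "list_all (true_stmt M) H" "outputs M R H \<rho> m K" for H m K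
    using outputs_unique[OF assms that(2) R(2)] that(1) neg by simp
  then have "valid_rule M \<rho> R"
    unfolding valid_rule_def by blast
  \<comment> \<open>The terms outside the base are at most \<open>R\<close>, and there are none if
    \<open>R\<close> already belongs to the base.\<close>
  then have "valid_outside M \<B> \<rho>"
    unfolding valid_outside_def \<rho>(2) by blast
  moreover have "base_library M \<B> \<rho>"
    using \<rho> unfolding base_library_def by blast
  ultimately have "valid_library M \<rho>"
    using \<B> unfolding stable_base_def by blast
  \<comment> \<open>\<open>P\<close> lies in the base, so its validity comes from stability
    alone.\<close>
  then have "valid_rule M \<rho> P"
    using P(1) \<rho>(2) unfolding valid_library_def by blast
  moreover have "is_rule M P" "alg_seq M \<rho>"
    using base P(1) \<rho>(1) unfolding base_def library_def by blast+
  ultimately show False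
    using explosion_not_valid[OF assms P(2) _ A neg] by blast
qed

end
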